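(* Let $p=\infty$ and consider the function $$G(\boldsymbol x)=\min_{\boldsymbol\xi:\|\boldsymbol\xi-\boldsymbol\xi^0\|_\infty\le\theta}\ \max_{k\in[K]}\{\boldsymbol\xi^\top\boldsymbol a_k(\boldsymbol x)+b_k(\boldsymbol x)\},\qquad\boldsymbol x\in\mathcal X,$$ with domain $\mathcal X$. Then $G$ is MICP-R if one of the following conditions holds: (i) $\boldsymbol a_k(\boldsymbol x)=\boldsymbol a_1(\boldsymbol x)$ for each $k\in[K]$; or (ii) $\boldsymbol\xi=[\boldsymbol\xi_1,\dots,\boldsymbol\xi_K]$ is partitioned into non-overlapping blocks $\boldsymbol\xi_k\in\mathbb R^{m_k}$ with $\sum_{k\in[K]}m_k=m$, such that $\boldsymbol\xi^\top\boldsymbol a_k(\boldsymbol x)=\boldsymbol\xi_k^\top\bar{\boldsymbol a}_k(\boldsymbol x)$ for each $k\in[K]$, where $\bar{\boldsymbol a}_k(\boldsymbol x)=\bar{\boldsymbol A}_k\boldsymbol x+\bar{\boldsymbol a}_k\in\mathbb R^{m_k}$ with $\bar{\boldsymbol A}_k\in\mathbb R^{m_k\times n}$, $\bar{\boldsymbol a}_k\in\mathbb R^{m_k}$ (the data of different blocks not overlapping).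
   Context: $[K]=\{1,\dots,K\}$. $\mathcal X\subseteq\mathbb R^n$ is a compact convex set with non-empty relative interior. For $k\in[K]$, $\boldsymbol a_k(\boldsymbol x)=\hat{\boldsymbol A}_k\boldsymbol x+\hat{\boldsymbol a}_k\in\mathbb R^m$ and $b_k(\boldsymbol x)=\hat{\boldsymbol B}_k^\top\boldsymbol x+\hat b_k\in\mathbb R$ are affine. $\boldsymbol\xi^0\in\mathbb R^m$, $\theta\ge0$. MICP-R (mixed-integer convex programming representable): a set $S\subseteq\mathbb R^n$ is MICP-R if there are integers $r,d$ and a closed convex set $M\subseteq\mathbb R^{n+r+d}$ such that $\boldsymbol x\in S$ if and only if there exist $\boldsymbol y\in\mathbb R^r$, $\boldsymbol z\in\mathbb Z^d$ with $(\boldsymbol x,\boldsymbol y,\boldsymbol z)\in M$. A function $f:S\to\mathbb R$ is MICP-R if both its domain $S$ and its epigraph $\{(\boldsymbol x,t):\boldsymbol x\in S,\ f(\boldsymbol x)\le t\}$ are MICP-R. *)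

theory Defs
  imports "HOL-Analysis.Analysis"
begin

text \<open>
  The numbers of auxiliary variables in a mixed-integer representation are existentially
  quantified, so the space of these variables cannot be a type. The space of vectors with \<open>r\<close>
  real entries is \<open>Euclidean_space r\<close>: the functions of type \<open>nat \<Rightarrow> real\<close> that vanish from
  index \<open>r\<close> on, with the product topology. Since \<open>nat \<Rightarrow> real\<close> is not an instance of
  \<open>real_vector\<close>, convexity in \<open>'a \<times> (nat \<Rightarrow> real) \<times> (nat \<Rightarrow> real)\<close> is spelled out following
  \<open>convex_def\<close>, with the vector operations taken componentwise.
\<close>

definition convex_ext :: "('a::real_vector \<times> (nat \<Rightarrow> real) \<times> (nat \<Rightarrow> real)) set \<Rightarrow> bool"
  where "convex_ext M \<longleftrightarrow>
    (\<forall>x y z x' y' z' u v.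
       (x, y, z) \<in> M \<longrightarrow> (x', y', z') \<in> M \<longrightarrow> u \<ge> 0 \<longrightarrow> v \<ge> 0 \<longrightarrow> u + v = 1 \<longrightarrow>
       (u *\<^sub>R x + v *\<^sub>R x', (\<lambda>i. u * y i + v * y' i), (\<lambda>j. u * z j + v * z' j)) \<in> M)"

text \<open>
  In the next definition \<open>closedin\<close> also forces \<open>M\<close> to lie in
  \<open>UNIV \<times> topspace (Euclidean_space r) \<times> topspace (Euclidean_space d)\<close>, so for \<open>(x, y, z) \<in> M\<close>
  the vectors \<open>y\<close> and \<open>z\<close> have \<open>r\<close> and \<open>d\<close> entries. The ambient type \<open>'a\<close> is a Euclidean
  space, such as \<open>real^'n\<close> for a set of points and \<open>(real^'n) \<times> real\<close> for an epigraph.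
\<close>

definition MICP_R :: "'a::euclidean_space set \<Rightarrow> bool"
  where "MICP_R S \<longleftrightarrow>
    (\<exists>(r::nat) (d::nat) (M :: ('a \<times> (nat \<Rightarrow> real) \<times> (nat \<Rightarrow> real)) set).
       closedin (prod_topology euclidean (prod_topology (Euclidean_space r) (Euclidean_space d))) M \<and>
       convex_ext M \<and>
       (\<forall>x. x \<in> S \<longleftrightarrow> (\<exists>y z. (\<forall>j<d. z j \<in> \<int>) \<and> (x, y, z) \<in> M)))"

definition MICP_R_fun :: "'a::euclidean_space set \<Rightarrow> ('a \<Rightarrow> real) \<Rightarrow> bool"
  where "MICP_R_fun S f \<longleftrightarrow> MICP_R S \<and> MICP_R (epigraph S f)"

definition affine_max ::
  "nat \<Rightarrow> (nat \<Rightarrow> real^'n^'m) \<Rightarrow> (nat \<Rightarrow> real^'m) \<Rightarrow> (nat \<Rightarrow> real^'n) \<Rightarrow> (nat \<Rightarrow> real) \<Rightarrow>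
    real^'n \<Rightarrow> real^'m \<Rightarrow> real"
  where "affine_max K A a B b x \<xi> = (MAX k\<in>{1..K}. \<xi> \<bullet> (A k *v x + a k) + (B k \<bullet> x + b k))"

text \<open>
  The minimum over the \<open>\<infinity>\<close>-norm ball is written as an infimum; for \<open>K \<ge> 1\<close> and \<open>\<theta> \<ge> 0\<close> it is
  attained, as shown below.
\<close>

definition min_affine_max ::
  "nat \<Rightarrow> (nat \<Rightarrow> real^'n^'m) \<Rightarrow> (nat \<Rightarrow> real^'m) \<Rightarrow> (nat \<Rightarrow> real^'n) \<Rightarrow> (nat \<Rightarrow> real) \<Rightarrow>
    real^'m \<Rightarrow> real \<Rightarrow> real^'n \<Rightarrow> real"
  where "min_affine_max K A a B b \<xi>0 \<theta> x =
    (INF \<xi>\<in>{\<xi>. infnorm (\<xi> - \<xi>0) \<le> \<theta>}. affine_max K A a B b x \<xi>)"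

lemma continuous_on_Max_image:
  fixes f :: "'i \<Rightarrow> 'a::topological_space \<Rightarrow> real"
  assumes "finite I" "I \<noteq> {}" "\<And>i. i \<in> I \<Longrightarrow> continuous_on S (f i)"
  shows "continuous_on S (\<lambda>x. MAX i\<in>I. f i x)"
  using assms
proof (induction I rule: finite_ne_induct)
  case (insert i I)
  then have "(\<lambda>x. MAX j\<in>insert i I. f j x) = (\<lambda>x. max (f i x) (MAX j\<in>I. f j x))"
    by (auto simp: Max_insert)
  with insert show ?case
    by (auto intro!: continuous_on_max)
qed auto

lemma compact_infnorm_ball: "compact {\<xi>::'a::euclidean_space. infnorm (\<xi> - c) \<le> \<theta>}"
proof -
  have "closed {\<xi>::'a. infnorm (\<xi> - c) \<le> \<theta>}"
    by (intro closed_Collect_le continuous_intros)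
  moreover have "{\<xi>::'a. infnorm (\<xi> - c) \<le> \<theta>} \<subseteq> cball c (sqrt DIM('a) * \<theta>)"
  proof
    fix \<xi> assume "\<xi> \<in> {\<xi>::'a. infnorm (\<xi> - c) \<le> \<theta>}"
    then have "sqrt DIM('a) * infnorm (\<xi> - c) \<le> sqrt DIM('a) * \<theta>"
      by (intro mult_left_mono) auto
    with norm_le_infnorm[of "\<xi> - c"] have "norm (\<xi> - c) \<le> sqrt DIM('a) * \<theta>"
      by linarith
    then show "\<xi> \<in> cball c (sqrt DIM('a) * \<theta>)"
      by (simp add: dist_norm norm_minus_commute)
  qed
  ultimately show ?thesis
    using bounded_subset[OF bounded_cball] compact_eq_bounded_closed by blast
qed

lemma min_affine_max_attained:
  fixes A :: "nat \<Rightarrow> real^'n^'m"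
  assumes "K \<ge> 1" "\<theta> \<ge> 0"
  shows "\<exists>\<xi>. infnorm (\<xi> - \<xi>0) \<le> \<theta> \<and>
      min_affine_max K A a B b \<xi>0 \<theta> x = affine_max K A a B b x \<xi> \<and>
      (\<forall>\<xi>'. infnorm (\<xi>' - \<xi>0) \<le> \<theta> \<longrightarrow> affine_max K A a B b x \<xi> \<le> affine_max K A a B b x \<xi>')"
proof -
  let ?D = "{\<xi>. infnorm (\<xi> - \<xi>0) \<le> \<theta>}"
  have "continuous_on ?D (affine_max K A a B b x)"
    unfolding affine_max_def using assms
    by (intro continuous_on_Max_image continuous_intros) auto
  moreover have "\<xi>0 \<in> ?D"
    using assms by (simp add: infnorm_0)
  ultimately obtain \<xi> where "\<xi> \<in> ?D"
    and *: "\<forall>\<xi>'\<in>?D. affine_max K A a B b x \<xi> \<le> affine_max K A a B b x \<xi>'"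
    using continuous_attains_inf[OF compact_infnorm_ball] by blast
  then have "min_affine_max K A a B b \<xi>0 \<theta> x = affine_max K A a B b x \<xi>"
    unfolding min_affine_max_def by (intro cInf_eq_minimum) auto
  with \<open>\<xi> \<in> ?D\<close> * show ?thesis
    by blast
qed

text \<open>
  In the block condition the coordinates of \<open>\<xi>\<close> are labelled by the finite type \<open>'m\<close>; block \<open>k\<close>
  consists of the coordinates in \<open>J k\<close>, so that \<open>m\<^sub>k = card (J k)\<close>. The \<open>m\<^sub>k\<close> rows of the block
  data are the rows of \<open>Abar k\<close> and \<open>abar k\<close> with index in \<open>J k\<close>; the other rows are not used.
  The identity is required on \<open>X\<close> only.
\<close>

definition block_separable ::
  "nat \<Rightarrow> (real^'n) set \<Rightarrow> (nat \<Rightarrow> real^'n^'m) \<Rightarrow> (nat \<Rightarrow> real^'m) \<Rightarrow> bool"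
  where "block_separable K X A a \<longleftrightarrow>
    (\<exists>(J :: nat \<Rightarrow> 'm set) (Abar :: nat \<Rightarrow> real^'n^'m) (abar :: nat \<Rightarrow> real^'m).
       disjoint_family_on J {1..K} \<and> (\<Union>k\<in>{1..K}. J k) = UNIV \<and>
       (\<forall>k\<in>{1..K}. \<forall>x\<in>X. \<forall>\<xi>.
          \<xi> \<bullet> (A k *v x + a k) = (\<Sum>i\<in>J k. \<xi> $ i * (Abar k *v x + abar k) $ i)))"

end

theory Submission
  imports Defs
begin

text \<open>
  For fixed \<open>x\<close> the coordinates of \<open>\<xi>\<close> can be optimised one at a time: each condition guarantees a
  single vector of coefficients whose signs determine, simultaneously for all pieces of the
  maximum, in which direction to push \<open>\<xi> $ i\<close>. Hence the minimum over the box is attained at a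
  vertex, and \<open>G\<close> is a minimum of finitely many convex continuous functions \<open>f\<^sub>j\<close>, one per vertex.
  On a compact domain its epigraph has the big-M formulation
  \<open>f\<^sub>j x \<le> t + C * (1 - z\<^sub>j)\<close>, \<open>z\<^sub>j \<ge> 0\<close>, \<open>\<Sum>j. z\<^sub>j = 1\<close> with integer \<open>z\<close>.
\<close>

section \<open>Mixed-integer representations: closed convex sets and finite unions of
  epigraphs\<close>

text \<open>Sequences vanishing from a fixed index on form a closed subspace of the product space,
  so being closed relative to it amounts to being closed and contained in it. This lets closedness
  be checked with \<open>closed\<close> and continuity on the full type.\<close>

lemma closedin_prod_Euclidean_space_iff:
  fixes M :: "('a::topological_space \<times> (nat \<Rightarrow> real) \<times> (nat \<Rightarrow> real)) set"
  shows "closedin (prod_topology euclidean (prod_topology (Euclidean_space r) (Euclidean_space d))) M \<longleftrightarrow>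
    closed M \<and> (\<forall>(x, y, z)\<in>M. (\<forall>i\<ge>r. y i = 0) \<and> (\<forall>i\<ge>d. z i = 0))"
proof -
  let ?E = "\<lambda>n. {x :: nat \<Rightarrow> real. \<forall>i\<ge>n. x i = 0}"
  have top: "prod_topology euclidean (prod_topology (Euclidean_space r) (Euclidean_space d)) =
      subtopology euclidean ((UNIV::'a set) \<times> ?E r \<times> ?E d)"
    using prod_topology_subtopology_eu[of "UNIV :: 'a set" "?E r \<times> ?E d"]
    by (simp add: Euclidean_space_def euclidean_product_topology)
  have E: "closed (?E n)" for n
    using closedin_Euclidean_space_iff[of n "?E n"] closedin_topspace[of "Euclidean_space n"]
    by (simp add: topspace_Euclidean_space)
  have "closed ((UNIV::'a set) \<times> ?E r \<times> ?E d)"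
    by (intro closed_Times closed_UNIV E)
  then show ?thesis
    unfolding top by (auto simp: closedin_closed_eq)
qed

lemma MICP_R_closed_convex:
  fixes S :: "'a::euclidean_space set"
  assumes "closed S" "convex S"
  shows "MICP_R S"
proof -
  \<comment> \<open>No auxiliary variables are involved: \<open>Euclidean_space 0\<close> has the
    zero sequence as its only point.\<close>
  let ?M = "S \<times> {\<lambda>i::nat. 0::real} \<times> {\<lambda>i::nat. 0::real}"
  have "closed ?M"
    by (intro closed_Times assms closed_singleton)
  then have "closedin (prod_topology euclidean (prod_topology (Euclidean_space 0) (Euclidean_space 0))) ?M"
    by (simp add: closedin_prod_Euclidean_space_iff)
  moreover have "convex_ext ?M"
    using assms(2) by (auto simp: convex_ext_def convex_def)
  ultimately show ?thesis
    unfolding MICP_R_def by (intro exI[of _ 0] exI[of _ ?M]) auto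
qed

lemma MICP_R_Union_epigraph:
  fixes f :: "'i \<Rightarrow> 'a::euclidean_space \<Rightarrow> real"
  assumes "finite I" "compact S"
    and cvx: "\<And>i. i \<in> I \<Longrightarrow> convex_on S (f i)"
    and cont: "\<And>i. i \<in> I \<Longrightarrow> continuous_on S (f i)"
  shows "MICP_R (\<Union>i\<in>I. epigraph S (f i))"
proof (cases "I = {}")
  case True
  then show ?thesis
    by (simp add: MICP_R_closed_convex)
next
  case False
  \<comment> \<open>\<open>convex_on\<close> includes convexity of the domain, but an index is
    needed to extract it; hence the separate case of empty \<open>I\<close>.\<close>
  then have "convex S"
    using cvx by (auto simp: convex_on_def)
  have "closed S"
    using \<open>compact S\<close> by (rule compact_imp_closed)
  have "bounded (\<Union>i\<in>I. f i ` S)"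
    using assms by (intro bounded_UN ballI compact_imp_bounded compact_continuous_image) auto
  then obtain C where C: "\<bar>f i x\<bar> \<le> C" if "i \<in> I" "x \<in> S" for i x
    by (auto simp: bounded_iff)
  obtain h where h: "bij_betw h {0..<card I} I"
    using ex_bij_betw_nat_finite[OF \<open>finite I\<close>] by blast
  define d where "d = card I"
  have hI: "h j \<in> I" if "j < d" for j
    using h that by (auto simp: bij_betw_def d_def)
  have Ih: "\<exists>j<d. h j = i" if "i \<in> I" for i
    using h that by (force simp: bij_betw_def d_def)
  \<comment> \<open>The factor \<open>2 * C\<close> makes the constraints of unselected pieces
    vacuous: if some piece satisfies \<open>f i x \<le> t\<close>, then \<open>t \<ge> - C\<close>,
    so \<open>t + 2 * C \<ge> C\<close> dominates every other piece. The \<open>y\<close> part is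
    trivial.\<close>
  define M :: "(('a \<times> real) \<times> (nat \<Rightarrow> real) \<times> (nat \<Rightarrow> real)) set" where
    "M = {((x, t), y, z). x \<in> S \<and> (\<forall>i. y i = 0) \<and> (\<forall>i\<ge>d. z i = 0) \<and> (\<Sum>i<d. z i) = 1 \<and>
          (\<forall>j<d. z j \<ge> 0 \<and> f (h j) x \<le> t + 2 * C * (1 - z j))}"
  have coord: "continuous_on UNIV (\<lambda>p :: ('a \<times> real) \<times> (nat \<Rightarrow> real) \<times> (nat \<Rightarrow> real). fst (snd p) i)"
    "continuous_on UNIV (\<lambda>p :: ('a \<times> real) \<times> (nat \<Rightarrow> real) \<times> (nat \<Rightarrow> real). snd (snd p) i)" for i
    by (rule continuous_on_product_then_coordinatewise[OF continuous_on_fst[OF continuous_on_snd[OF continuous_on_id]]]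
        continuous_on_product_then_coordinatewise[OF continuous_on_snd[OF continuous_on_snd[OF continuous_on_id]]])+
  have "closed M"
  proof -
    let ?P = "(S \<times> UNIV) \<times> UNIV :: (('a \<times> real) \<times> (nat \<Rightarrow> real) \<times> (nat \<Rightarrow> real)) set"
    have P: "closed ?P"
      by (intro closed_Times closed_UNIV \<open>closed S\<close>)
    \<comment> \<open>Each \<open>f (h j)\<close> is continuous only on \<open>S\<close>, so its
      constraint is imposed inside the closed set \<open>?P\<close>.\<close>
    have "closed {p \<in> ?P. f (h j) (fst (fst p)) \<le> snd (fst p) + 2 * C * (1 - snd (snd p) j)}"
      if "j < d" for j
    proof (rule continuous_on_closed_Collect_le[OF _ _ P])
      show "continuous_on ?P (\<lambda>p. f (h j) (fst (fst p)))"
        by (rule continuous_on_compose2[OF cont[OF hI[OF that]]]) (auto intro!: continuous_intros)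
      show "continuous_on ?P (\<lambda>p. snd (fst p) + 2 * C * (1 - snd (snd p) j))"
        by (intro continuous_intros continuous_on_subset[OF coord(2)]) auto
    qed
    then have 1: "closed (\<Inter>j\<in>{..<d}. {p \<in> ?P. f (h j) (fst (fst p)) \<le> snd (fst p) + 2 * C * (1 - snd (snd p) j)})"
      by (intro closed_INT) auto
    have "closed {p :: ('a \<times> real) \<times> (nat \<Rightarrow> real) \<times> (nat \<Rightarrow> real). fst (snd p) i = 0}"
      "closed {p :: ('a \<times> real) \<times> (nat \<Rightarrow> real) \<times> (nat \<Rightarrow> real). snd (snd p) i = 0}"
      "closed {p :: ('a \<times> real) \<times> (nat \<Rightarrow> real) \<times> (nat \<Rightarrow> real). 0 \<le> snd (snd p) i}" for i
      by (rule closed_Collect_eq closed_Collect_le coord continuous_on_const)+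
    moreover have "closed {p :: ('a \<times> real) \<times> (nat \<Rightarrow> real) \<times> (nat \<Rightarrow> real). (\<Sum>i<d. snd (snd p) i) = 1}"
      by (rule closed_Collect_eq continuous_on_sum coord continuous_on_const)+
    ultimately have 2: "closed (?P \<inter> (\<Inter>i. {p. fst (snd p) i = 0}) \<inter> (\<Inter>i\<in>{d..}. {p. snd (snd p) i = 0}) \<inter>
        {p. (\<Sum>i<d. snd (snd p) i) = 1} \<inter> (\<Inter>j\<in>{..<d}. {p. 0 \<le> snd (snd p) j}))"
      using P by (intro closed_Int closed_INT ballI) simp_all
    have "M = (?P \<inter> (\<Inter>i. {p. fst (snd p) i = 0}) \<inter> (\<Inter>i\<in>{d..}. {p. snd (snd p) i = 0}) \<inter>
        {p. (\<Sum>i<d. snd (snd p) i) = 1} \<inter> (\<Inter>j\<in>{..<d}. {p. 0 \<le> snd (snd p) j})) \<inter>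
      (\<Inter>j\<in>{..<d}. {p \<in> ?P. f (h j) (fst (fst p)) \<le> snd (fst p) + 2 * C * (1 - snd (snd p) j)})"
      by (auto simp: M_def)
    with closed_Int[OF 2 1] show ?thesis
      by simp
  qed
  then have "closedin (prod_topology euclidean (prod_topology (Euclidean_space 0) (Euclidean_space d))) M"
    by (auto simp: closedin_prod_Euclidean_space_iff M_def)
  moreover have "convex_ext M"
  proof -
    \<comment> \<open>The constraint bounds a convex function of \<open>x\<close> by an affine
      function of \<open>t\<close> and \<open>z\<close>, so it survives convex combinations; the
      constant 1 combines to \<open>u + v\<close>.\<close>
    have "f (h j) (u *\<^sub>R x + v *\<^sub>R x') \<le> u * t + v * t' + 2 * C * (1 - (u * z + v * z'))"
      if "u \<ge> 0" "v \<ge> 0" "u + v = 1" "j < d" "x \<in> S" "x' \<in> S"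
        and z: "f (h j) x \<le> t + 2 * C * (1 - z)" "f (h j) x' \<le> t' + 2 * C * (1 - z')"
      for u v x x' t t' z z' j
    proof -
      have "f (h j) (u *\<^sub>R x + v *\<^sub>R x') \<le> u * f (h j) x + v * f (h j) x'"
        using cvx[OF hI[OF \<open>j < d\<close>]] that by (auto simp: convex_on_def)
      also have "\<dots> \<le> u * (t + 2 * C * (1 - z)) + v * (t' + 2 * C * (1 - z'))"
        using that by (intro add_mono mult_left_mono) auto
      also have "\<dots> = u * t + v * t' + 2 * C * ((u + v) - (u * z + v * z'))"
        by (simp add: algebra_simps)
      finally show ?thesis
        using \<open>u + v = 1\<close> by simp
    qed
    moreover have "(\<Sum>i<d. u * z i + v * z' i) = 1"
      if "u + v = 1" "(\<Sum>i<d. z i) = 1" "(\<Sum>i<d. z' i) = 1" for u v :: real and z z'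
      using that by (simp add: sum.distrib flip: sum_distrib_left)
    ultimately show ?thesis
      using \<open>convex S\<close> unfolding convex_ext_def M_def convex_def by simp
  qed
  moreover have "p \<in> (\<Union>i\<in>I. epigraph S (f i)) \<longleftrightarrow> (\<exists>y z. (\<forall>j<d. z j \<in> \<int>) \<and> (p, y, z) \<in> M)" for p
  proof
    assume "p \<in> (\<Union>i\<in>I. epigraph S (f i))"
    then obtain x t i where p: "p = (x, t)" "i \<in> I" "x \<in> S" "f i x \<le> t"
      by (cases p) (auto simp: mem_epigraph)
    obtain k where k: "k < d" "h k = i"
      using Ih \<open>i \<in> I\<close> by blast
    define z :: "nat \<Rightarrow> real" where "z = (\<lambda>j. if j = k then 1 else 0)"
    have "f (h j) x \<le> t + 2 * C * (1 - z j)" if "j < d" for j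
      \<comment> \<open>The bound enters twice: from above for piece \<open>j\<close>, and from
        below for piece \<open>i\<close>, which gives \<open>t \<ge> - C\<close>.\<close>
      using C[OF hI[OF that] \<open>x \<in> S\<close>] C[OF \<open>i \<in> I\<close> \<open>x \<in> S\<close>] p k by (auto simp: z_def)
    then have "(p, \<lambda>i. 0, z) \<in> M"
      using p k by (auto simp: M_def z_def)
    then show "\<exists>y z. (\<forall>j<d. z j \<in> \<int>) \<and> (p, y, z) \<in> M"
      by (intro exI[of _ "\<lambda>i. 0"] exI[of _ z]) (auto simp: z_def)
  next
    assume "\<exists>y z. (\<forall>j<d. z j \<in> \<int>) \<and> (p, y, z) \<in> M"
    then obtain y z x t where z: "\<forall>j<d. z j \<in> \<int>" "(p, y, z) \<in> M" and p: "p = (x, t)"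
      by (cases p) auto
    from z p have M: "x \<in> S" "(\<Sum>i<d. z i) = 1" "\<And>j. j < d \<Longrightarrow> z j \<ge> 0"
      "\<And>j. j < d \<Longrightarrow> f (h j) x \<le> t + 2 * C * (1 - z j)"
      by (auto simp: M_def)
    \<comment> \<open>Nonnegative integers with sum 1: a nonzero entry is at least 1 and at most the
      sum, hence equal to 1, and its big-M term vanishes.\<close>
    obtain j where j: "j < d" "z j \<noteq> 0"
      using M(2) by (metis lessThan_iff sum.neutral zero_neq_one)
    have "z j \<ge> 1"
      using z(1) j M(3)[OF j(1)] by (auto elim!: Ints_cases)
    moreover have "z j \<le> (\<Sum>i<d. z i)"
      using j M(3) by (intro member_le_sum) auto
    ultimately have "f (h j) x \<le> t"
      using M(2) M(4)[OF j(1)] by simp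
    then show "p \<in> (\<Union>i\<in>I. epigraph S (f i))"
      using hI[OF j(1)] M(1) p by (auto simp: mem_epigraph)
  qed
  ultimately show ?thesis
    unfolding MICP_R_def by (intro exI[of _ 0] exI[of _ d] exI[of _ M]) simp
qed

section \<open>Affine maxima and vertices of the infinity-norm box\<close>

lemma infnorm_le_iff_cart: "infnorm (x::real^'n) \<le> c \<longleftrightarrow> (\<forall>i. \<bar>x $ i\<bar> \<le> c)"
proof
  show "\<forall>i. \<bar>x $ i\<bar> \<le> c" if "infnorm x \<le> c"
    using that component_le_infnorm_cart order_trans by blast
  show "infnorm x \<le> c" if "\<forall>i. \<bar>x $ i\<bar> \<le> c"
    unfolding infnorm_cart using that by (intro cSup_least) auto
qed

lemma continuous_on_affine_max:
  fixes A :: "nat \<Rightarrow> real^'n^'m"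
  assumes "K \<ge> 1"
  shows "continuous_on S (\<lambda>x. affine_max K A a B b x \<xi>)"
  unfolding affine_max_def using assms
  by (intro continuous_on_Max_image continuous_intros) auto

lemma affine_max_le_iff:
  assumes "K \<ge> 1"
  shows "affine_max K A a B b x \<xi> \<le> t \<longleftrightarrow>
    (\<forall>k\<in>{1..K}. \<xi> \<bullet> (A k *v x + a k) + (B k \<bullet> x + b k) \<le> t)"
  unfolding affine_max_def using assms by (subst Max_le_iff) auto

lemma convex_on_affine_max:
  fixes A :: "nat \<Rightarrow> real^'n^'m"
  assumes "K \<ge> 1" "convex S"
  shows "convex_on S (\<lambda>x. affine_max K A a B b x \<xi>)"
  unfolding convex_on_def affine_max_le_iff[OF \<open>K \<ge> 1\<close>]
proof (intro conjI \<open>convex S\<close> ballI allI impI)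
  fix x x' u v k
  assume uv: "(0::real) \<le> u" "0 \<le> v" "u + v = 1" and k: "k \<in> {1..K}"
  let ?g = "\<lambda>x. \<xi> \<bullet> (A k *v x + a k) + (B k \<bullet> x + b k)"
  have le: "?g x \<le> affine_max K A a B b x \<xi>" for x
    using affine_max_le_iff[OF \<open>K \<ge> 1\<close>] k by blast
  \<comment> \<open>Eliminating \<open>v\<close> lets the constant terms of the affine map recombine
    with total weight 1.\<close>
  have v: "v = 1 - u"
    using uv by simp
  have "?g (u *\<^sub>R x + v *\<^sub>R x') = u * ?g x + v * ?g x'"
    unfolding v by (simp add: matrix_vector_right_distrib matrix_vector_mult_scaleR
        inner_add_right algebra_simps)
  also have "\<dots> \<le> u * affine_max K A a B b x \<xi> + v * affine_max K A a B b x' \<xi>"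
    using uv le by (intro add_mono mult_left_mono) auto
  finally show "?g (u *\<^sub>R x + v *\<^sub>R x') \<le> \<dots>" .
qed

text \<open>Indexing vertices by the coordinates at their lower bound makes the index type
  \<open>'m set\<close> finite, as the later union of epigraphs requires.\<close>

definition box_vertex :: "real^'m \<Rightarrow> real \<Rightarrow> 'm set \<Rightarrow> real^'m"
  where "box_vertex c \<theta> U = (\<chi> i. if i \<in> U then c $ i - \<theta> else c $ i + \<theta>)"

lemma infnorm_box_vertex: "\<theta> \<ge> 0 \<Longrightarrow> infnorm (box_vertex c \<theta> U - c) \<le> \<theta>"
  by (simp add: infnorm_le_iff_cart box_vertex_def)

text \<open>A linear function on an interval is smallest at the lower end if its slope is
  nonnegative and at the upper end otherwise.\<close>

lemma box_vertex_mult_le: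
  assumes "infnorm (\<xi> - c) \<le> \<theta>"
  shows "box_vertex c \<theta> {i. w i \<ge> 0} $ i * w i \<le> \<xi> $ i * w i"
proof -
  have "\<bar>\<xi> $ i - c $ i\<bar> \<le> \<theta>"
    using assms by (simp add: infnorm_le_iff_cart)
  then show ?thesis
    by (cases "w i \<ge> 0") (auto simp: box_vertex_def intro: mult_right_mono mult_right_mono_neg)
qed

text \<open>The point is that one \<open>U\<close> serves all pieces at once. With a common
  coefficient vector there is one sign pattern; with disjoint blocks each coordinate occurs in a
  single piece, so the preferred directions cannot conflict.\<close>

lemma exists_box_vertex_le:
  fixes A :: "nat \<Rightarrow> real^'n^'m"
  assumes cond: "(\<forall>k\<in>{1..K}. \<forall>x\<in>X. A k *v x + a k = A 1 *v x + a 1) \<or> block_separable K X A a"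
    and "x \<in> X" and \<xi>: "infnorm (\<xi> - \<xi>0) \<le> \<theta>"
  shows "\<exists>U. \<forall>k\<in>{1..K}. box_vertex \<xi>0 \<theta> U \<bullet> (A k *v x + a k) \<le> \<xi> \<bullet> (A k *v x + a k)"
  using cond
proof
  assume eq: "\<forall>k\<in>{1..K}. \<forall>x\<in>X. A k *v x + a k = A 1 *v x + a 1"
  let ?U = "{i. (A 1 *v x + a 1) $ i \<ge> 0}"
  have "box_vertex \<xi>0 \<theta> ?U \<bullet> (A 1 *v x + a 1) \<le> \<xi> \<bullet> (A 1 *v x + a 1)"
    unfolding inner_vec_def inner_real_def by (intro sum_mono box_vertex_mult_le \<xi>)
  moreover have "A k *v x + a k = A 1 *v x + a 1" if "k \<in> {1..K}" for k
    using eq \<open>x \<in> X\<close> that by blast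
  ultimately show ?thesis
    by metis
next
  assume "block_separable K X A a"
  then obtain J Abar abar where disj: "disjoint_family_on J {1..K}"
    and J: "\<And>k \<xi>. k \<in> {1..K} \<Longrightarrow>
      \<xi> \<bullet> (A k *v x + a k) = (\<Sum>i\<in>J k. \<xi> $ i * ((Abar k :: real^'n^'m) *v x + abar k) $ i)"
    using \<open>x \<in> X\<close> unfolding block_separable_def by blast
  \<comment> \<open>Disjointness makes the block containing a coordinate unique, so the coefficients
    of all blocks can be assembled into the single vector \<open>w\<close>.\<close>
  define \<kappa> where "\<kappa> i = (THE k. k \<in> {1..K} \<and> i \<in> J k)" for i
  have \<kappa>: "\<kappa> i = k" if "k \<in> {1..K}" "i \<in> J k" for i k
    unfolding \<kappa>_def using that disj
    by (intro the_equality) (blast dest: disjoint_family_onD)+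
  define w where "w i = (Abar (\<kappa> i) *v x + abar (\<kappa> i)) $ i" for i
  show ?thesis
  proof (intro exI[of _ "{i. w i \<ge> 0}"] ballI)
    fix k assume k: "k \<in> {1..K}"
    have *: "\<eta> \<bullet> (A k *v x + a k) = (\<Sum>i\<in>J k. \<eta> $ i * w i)" for \<eta>
      using J[OF k] \<kappa>[OF k] by (simp add: w_def)
    show "box_vertex \<xi>0 \<theta> {i. w i \<ge> 0} \<bullet> (A k *v x + a k) \<le> \<xi> \<bullet> (A k *v x + a k)"
      unfolding * by (intro sum_mono box_vertex_mult_le \<xi>)
  qed
qed

text \<open>Moving a minimiser to the right vertex lowers no piece's slack: each inner product does
  not increase and the terms \<open>B k \<bullet> x + b k\<close> do not involve
  \<open>\<xi>\<close>. Conversely, vertices lie in the box, so their values are at least the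
  minimum.\<close>

lemma min_affine_max_le_iff_box_vertex:
  fixes A :: "nat \<Rightarrow> real^'n^'m"
  assumes "K \<ge> 1" "\<theta> \<ge> 0" "x \<in> X"
    and "(\<forall>k\<in>{1..K}. \<forall>x\<in>X. A k *v x + a k = A 1 *v x + a 1) \<or> block_separable K X A a"
  shows "min_affine_max K A a B b \<xi>0 \<theta> x \<le> t \<longleftrightarrow>
    (\<exists>U. affine_max K A a B b x (box_vertex \<xi>0 \<theta> U) \<le> t)"
proof -
  obtain \<xi> where \<xi>: "infnorm (\<xi> - \<xi>0) \<le> \<theta>"
    and eq: "min_affine_max K A a B b \<xi>0 \<theta> x = affine_max K A a B b x \<xi>"
    and le: "\<And>\<xi>'. infnorm (\<xi>' - \<xi>0) \<le> \<theta> \<Longrightarrow> affine_max K A a B b x \<xi> \<le> affine_max K A a B b x \<xi>'"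
    using min_affine_max_attained[OF assms(1,2)] by metis
  obtain U where U: "\<And>k. k \<in> {1..K} \<Longrightarrow>
      box_vertex \<xi>0 \<theta> U \<bullet> (A k *v x + a k) \<le> \<xi> \<bullet> (A k *v x + a k)"
    using exists_box_vertex_le[OF assms(4,3) \<xi>] by blast
  have "affine_max K A a B b x (box_vertex \<xi>0 \<theta> U) \<le> t" if "affine_max K A a B b x \<xi> \<le> t"
    using that U unfolding affine_max_le_iff[OF assms(1)] by force
  moreover have "affine_max K A a B b x \<xi> \<le> affine_max K A a B b x (box_vertex \<xi>0 \<theta> U)" for U
    by (intro le infnorm_box_vertex assms)
  ultimately show ?thesis
    unfolding eq by (meson order_trans)
qed

theorem theorem4:
  fixes X :: "(real^'n) set"
    and K :: nat
    and A :: "nat \<Rightarrow> real^'n^'m"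
    and a :: "nat \<Rightarrow> real^'m"
    and B :: "nat \<Rightarrow> real^'n"
    and b :: "nat \<Rightarrow> real"
    and \<xi>0 :: "real^'m"
    and \<theta> :: real
  assumes "compact X" "convex X" "rel_interior X \<noteq> {}"
    and "K \<ge> 1"
    and "\<theta> \<ge> 0"
    and "(\<forall>k\<in>{1..K}. \<forall>x\<in>X. A k *v x + a k = A 1 *v x + a 1) \<or> block_separable K X A a"
  shows "MICP_R_fun X (min_affine_max K A a B b \<xi>0 \<theta>)"
  unfolding MICP_R_fun_def
proof
  show "MICP_R X"
    using assms(1,2) by (simp add: MICP_R_closed_convex compact_imp_closed)
  \<comment> \<open>The existential over \<open>U\<close> becomes a finite union of epigraphs of
    convex continuous functions on the compact set \<open>X\<close>.\<close>
  have "epigraph X (min_affine_max K A a B b \<xi>0 \<theta>) =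
      (\<Union>U\<in>UNIV. epigraph X (\<lambda>x. affine_max K A a B b x (box_vertex \<xi>0 \<theta> U)))"
    using min_affine_max_le_iff_box_vertex[OF assms(4,5) _ assms(6)] by (auto simp: epigraph_def)
  also have "MICP_R \<dots>"
    using assms by (intro MICP_R_Union_epigraph continuous_on_affine_max convex_on_affine_max) auto
  finally show "MICP_R (epigraph X (min_affine_max K A a B b \<xi>0 \<theta>))" .
qed

end
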